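(* We have the equality $d_{BM}(\mathcal{C}_3, \mathcal{C}_3^* ) = \frac{9}{5}$. Moreover, if a linear operator $T: \mathbb{R}^3 \to \mathbb{R}^3$ satisfies $\frac{5}{9}\, \mathcal{C}_3 \subseteq T(\mathcal{C}_3^* ) \subseteq \mathcal{C}_3$, then the matrix of $T$ (in the standard basis) is of the form $$\begin{bmatrix} \frac{1}{3} & -1 & -1\\ -1 & \frac{1}{3} & -1\\ -1 & -1 & \frac{1}{3} \end{bmatrix}$$ or arises from the matrix above by operations of permuting rows, permuting columns, multiplying a row by $-1$ and multiplying a column by $-1$ (there are in total $192$ such matrices).
   Context: A convex body in $\mathbb{R}^n$ ($n\ge 2$) is a compact convex set with non-empty interior. For convex bodies $K, L \subseteq \mathbb{R}^n$ the Banach-Mazur distance is $$d_{BM}(K,L) = \inf \{r >0 : K+ u \subseteq T(L+v) \subseteq r(K+u) \},$$ where the infimum is taken over all invertible linear operators $T : \mathbb{R}^n \to \mathbb{R}^n$ and vectors $u, v \in \mathbb{R}^n$. Here $\mathcal{C}_n = [-1,1]^n$ is the unit cube (the unit ball of the maximum norm) in $\mathbb{R}^n$ and $\mathcal{C}_n^* = \{x \in \mathbb{R}^n : |x_1| + \dots + |x_n| \leq 1\} = \operatorname{conv}\{\pm e_1, \dots, \pm e_n\}$ is its dual, the cross-polytope, where $e_1,\dots,e_n$ is the standard basis. *)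

theory Defs
  imports "HOL-Analysis.Analysis"
begin

definition unit_cube :: "(real ^ 'n) set" where
  "unit_cube = {x. \<forall>i. x $ i \<in> {-1..1}}"

definition cross_polytope :: "(real ^ 'n) set" where
  "cross_polytope = {x. (\<Sum>i\<in>UNIV. \<bar>x $ i\<bar>) \<le> 1}"

text \<open>
  Meaningful for convex bodies \<open>K\<close> and \<open>L\<close> (compact, convex, non-empty interior): the set of
  admissible \<open>r\<close> is then non-empty and bounded below, so that the real-valued \<open>Inf\<close> is a
  genuine infimum. No position of the origin relative to the translates is assumed.
\<close>

definition banach_mazur_dist :: "(real ^ 'n) set \<Rightarrow> (real ^ 'n) set \<Rightarrow> real" where
  "banach_mazur_dist K L =
     Inf {r. r > 0 \<and>
            (\<exists>T u v. linear T \<and> bij T \<and>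
               (\<lambda>x. x + u) ` K \<subseteq> T ` ((\<lambda>x. x + v) ` L) \<and>
               T ` ((\<lambda>x. x + v) ` L) \<subseteq> (\<lambda>x. r *\<^sub>R x) ` ((\<lambda>x. x + u) ` K))}"

text \<open>All matrices obtained from \<open>A\<close> by finitely many of the listed operations, in any order.\<close>

inductive_set signed_perm_orbit :: "real ^ 'n ^ 'm \<Rightarrow> (real ^ 'n ^ 'm) set"
  for A :: "real ^ 'n ^ 'm" where
  base: "A \<in> signed_perm_orbit A"
| permute_rows:
    "B \<in> signed_perm_orbit A \<Longrightarrow> p permutes UNIV \<Longrightarrow>
     (\<chi> i j. B $ p i $ j) \<in> signed_perm_orbit A"
| permute_columns:
    "B \<in> signed_perm_orbit A \<Longrightarrow> p permutes UNIV \<Longrightarrow>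
     (\<chi> i j. B $ i $ p j) \<in> signed_perm_orbit A"
| negate_row:
    "B \<in> signed_perm_orbit A \<Longrightarrow>
     (\<chi> i j. if i = k then - (B $ i $ j) else B $ i $ j) \<in> signed_perm_orbit A"
| negate_column:
    "B \<in> signed_perm_orbit A \<Longrightarrow>
     (\<chi> i j. if j = k then - (B $ i $ j) else B $ i $ j) \<in> signed_perm_orbit A"

definition extremal_matrix :: "real ^ 3 ^ 3" where
  "extremal_matrix = vector [vector [1/3, -1, -1],
                             vector [-1, 1/3, -1],
                             vector [-1, -1, 1/3]]"

end

theory Submission
  imports Defs
begin

text \<open>
  Let \<open>A\<close> be the matrix of \<open>T\<close>. The inclusion of the cross-polytope's image in the cube says that all
  entries of \<open>A\<close> lie in \<open>[-1, 1]\<close>. The inclusion of the cube of radius \<open>5/9\<close> says, by duality, that every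
  vector \<open>y\<close> has an image under the transpose of \<open>A\<close> whose maximum norm is at least \<open>5/9\<close> of the
  \<open>l1\<close>-norm of \<open>y\<close> (the predicate \<open>norming\<close>). The whole proof consists in choosing test vectors \<open>y\<close>.

  The vectors \<open>e_i + e_k\<close> and \<open>e_i - e_k\<close> force a combinatorial fact: for any two rows there is a
  column in which they have equal signs, and one in which they have opposite signs. In dimension 3
  this determines the signs of \<open>A\<close> up to the operations in the statement, so that \<open>A\<close> may be taken with
  non-negative diagonal and non-positive off-diagonal entries.

  For such an \<open>A\<close>, let \<open>q\<close> solve \<open>q A = (-1, -1, -1)\<close>. Then \<open>q\<close> is positive, and testing with \<open>q\<close> itself
  gives \<open>K \<le> 9/5\<close> for its coordinate sum \<open>K\<close>. The equations for \<open>q\<close> bound the diagonal entries from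
  above, because the off-diagonal entries are at least \<open>-1\<close>. The test vectors \<open>q - t e_k\<close> bound them from
  below. Together the two bounds give, with \<open>x = q_k\<close>, the inequality
  \<open>20 x (K - x) \<le> (K - 1)(9 + 5 K)\<close>. For \<open>K \<le> 9/5\<close> its right side is at most \<open>40 K^2 / 9\<close>, the value of the
  left side at \<open>x = K/3\<close>; since the coordinates are at most \<open>K - 1 < 2 K / 3\<close>, none can exceed \<open>K/3\<close>.
  But the three coordinates sum to \<open>K\<close>, so everything is an equality: \<open>K = 9/5\<close>, \<open>q = (3/5, 3/5, 3/5)\<close>, diagonal \<open>1/3\<close>, off-diagonal \<open>-1\<close>.

  For the distance, both bodies are convex and symmetric about 0, so translations can be dropped. If
  a ratio \<open>r < 9/5\<close> were attained by \<open>T\<close>, then \<open>5/9 T\<close> would satisfy the hypotheses above with all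
  entries strictly inside \<open>(-1, 1)\<close>, whereas every matrix in the orbit has entries \<open>1\<close> or \<open>-1\<close>.
\<close>

section \<open>Matrices norming the cross-polytope\<close>

text \<open>
  The dual form of the inclusion of \<open>5/9\<close> times the cube in the image of the cross-polytope: it compares
  the support functions of the two bodies, the \<open>l1\<close>-norm of \<open>y\<close> and the maximum norm of \<open>y v* A\<close>.
\<close>

definition norming :: "real ^ 'n ^ 'n \<Rightarrow> bool" where
  "norming A \<longleftrightarrow> (\<forall>y. \<exists>j. 5 / 9 * (\<Sum>i\<in>UNIV. \<bar>y $ i\<bar>) \<le> \<bar>(y v* A) $ j\<bar>)"

lemma normingD:
  assumes "norming A"
  obtains j where "5 / 9 * (\<Sum>i\<in>UNIV. \<bar>y $ i\<bar>) \<le> \<bar>(y v* A) $ j\<bar>"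
  using assms unfolding norming_def by blast

lemma linear_vector_matrix_mult: "linear (\<lambda>y. y v* (A :: real ^ 'n ^ 'm))"
  by (rule linearI) (simp_all add: vector_matrix_mult_def vec_eq_iff algebra_simps
      sum.distrib sum_distrib_left)

lemma axis_vector_matrix_mult: "(axis k 1 v* (A :: real ^ 'n ^ 'm)) $ j = A $ k $ j"
  by (simp add: vector_matrix_mult_def axis_def if_distrib[where f = "\<lambda>x. x * _"] cong: if_cong)

text \<open>
  The kernel of \<open>y \<mapsto> y v* A\<close> is trivial, since the \<open>l1\<close>-norm of \<open>y\<close> is controlled by its image.
\<close>

lemma norming_surj:
  fixes A :: "real ^ 'n ^ 'n"
  assumes "norming A"
  obtains q where "q v* A = b"
proof -
  have "inj (\<lambda>y. y v* A)"
  proof (rule linear_injective_on_subspace_0[OF _ subspace_UNIV, THEN iffD2, rule_format])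
    show "linear (\<lambda>y. y v* A)" by (rule linear_vector_matrix_mult)
    fix y assume "y \<in> UNIV" "y v* A = 0"
    then have "5 / 9 * (\<Sum>i\<in>UNIV. \<bar>y $ i\<bar>) \<le> 0"
      using normingD[OF assms, of y] by auto
    then have "(\<Sum>i\<in>UNIV. \<bar>y $ i\<bar>) = 0"
      by (intro antisym sum_nonneg) simp_all
    then show "y = 0"
      by (simp add: sum_nonneg_eq_0_iff vec_eq_iff)
  qed
  then have "surj (\<lambda>y. y v* A)"
    by (intro linear_injective_imp_surjective linear_vector_matrix_mult) simp_all
  then show ?thesis using that by (metis surjD)
qed

text \<open>
  Pair \<open>y\<close> with the point of the cube whose coordinates are the signs of \<open>y\<close>; its preimage in the
  cross-polytope has \<open>l1\<close>-norm at most 1.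
\<close>

lemma norming_matrix:
  fixes T :: "real ^ 'n \<Rightarrow> real ^ 'n"
  assumes T: "linear T" and sub: "(\<lambda>x. (5 / 9) *\<^sub>R x) ` unit_cube \<subseteq> T ` cross_polytope"
  shows "norming (matrix T)"
  unfolding norming_def
proof
  fix y :: "real ^ 'n"
  define m where "m = Max (range (\<lambda>j. \<bar>(y v* matrix T) $ j\<bar>))"
  have "(\<chi> i. sgn (y $ i)) \<in> unit_cube" by (simp add: unit_cube_def sgn_real_def)
  then obtain w where w: "(5 / 9) *\<^sub>R (\<chi> i. sgn (y $ i)) = T w" and w1: "(\<Sum>j\<in>UNIV. \<bar>w $ j\<bar>) \<le> 1"
    using sub by (auto simp: cross_polytope_def subset_iff image_iff)
  have m: "\<bar>(y v* matrix T) $ j\<bar> \<le> m" for j unfolding m_def by (rule Max_ge) auto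
  have "5 / 9 * (\<Sum>i\<in>UNIV. \<bar>y $ i\<bar>) = y \<bullet> ((5 / 9) *\<^sub>R (\<chi> i. sgn (y $ i)))"
    by (auto simp: inner_vec_def sum_distrib_left abs_sgn mult_ac intro!: sum.cong)
  also have "\<dots> = (y v* matrix T) \<bullet> w"
    unfolding w using T by (simp add: dot_lmul_matrix)
  also have "\<dots> \<le> (\<Sum>j\<in>UNIV. m * \<bar>w $ j\<bar>)"
    unfolding inner_vec_def
  proof (rule sum_mono)
    fix j
    have "(y v* matrix T) $ j \<bullet> w $ j \<le> \<bar>(y v* matrix T) $ j\<bar> * \<bar>w $ j\<bar>"
      by (simp flip: abs_mult)
    also have "\<dots> \<le> m * \<bar>w $ j\<bar>" by (intro mult_right_mono m) simp
    finally show "(y v* matrix T) $ j \<bullet> w $ j \<le> m * \<bar>w $ j\<bar>" .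
  qed
  also have "\<dots> = m * (\<Sum>j\<in>UNIV. \<bar>w $ j\<bar>)" by (simp add: sum_distrib_left)
  also have "\<dots> \<le> m * 1"
    using w1 order_trans[OF abs_ge_zero m] by (intro mult_left_mono) auto
  finally have "5 / 9 * (\<Sum>i\<in>UNIV. \<bar>y $ i\<bar>) \<le> m" by simp
  moreover have "m \<in> range (\<lambda>j. \<bar>(y v* matrix T) $ j\<bar>)" unfolding m_def by (rule Max_in) auto
  ultimately show "\<exists>j. 5 / 9 * (\<Sum>i\<in>UNIV. \<bar>y $ i\<bar>) \<le> \<bar>(y v* matrix T) $ j\<bar>" by auto
qed

text \<open>
  The columns of the matrix are images of vertices of the cross-polytope.
\<close>

lemma matrix_entries_bounded:
  fixes T :: "real ^ 'n \<Rightarrow> real ^ 'n"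
  assumes sub: "T ` cross_polytope \<subseteq> (\<lambda>x. r *\<^sub>R x) ` unit_cube" and r: "0 \<le> r"
  shows "\<bar>matrix T $ i $ j\<bar> \<le> r"
proof -
  have "(\<Sum>k\<in>UNIV. \<bar>axis j (1::real) $ k\<bar>) = (\<Sum>k\<in>UNIV. if k = j then 1 else 0)"
    by (rule sum.cong) (auto simp: axis_def)
  then have "axis j 1 \<in> cross_polytope" by (simp add: cross_polytope_def)
  then obtain x where x: "x \<in> unit_cube" "T (axis j 1) = r *\<^sub>R x" using sub by auto
  have "\<bar>x $ i\<bar> \<le> 1" using x(1) by (auto simp: unit_cube_def abs_le_iff minus_le_iff)
  then show ?thesis using x(2) r by (simp add: matrix_def abs_mult mult_left_le)
qed

section \<open>Rigidity for a fixed sign pattern\<close>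

text \<open>
  The signs of \<open>A\<close> make the \<open>k\<close>-th equation a balance: if \<open>q $ k \<ge> 0\<close>, then the positive parts of the other
  coordinates sum to at least 1. So one positive coordinate forces a second one, and if the third is not
  positive, then each of the two is at least 1, which exceeds the norm bound. If no coordinate is
  positive, then each is at most \<open>-1\<close>, which exceeds it as well.
\<close>

lemma solution_pos:
  fixes A :: "real ^ 3 ^ 3"
  assumes B: "\<And>i j. \<bar>A $ i $ j\<bar> \<le> 1"
    and off: "\<And>i j. i \<noteq> j \<Longrightarrow> A $ i $ j \<le> 0" and dg: "\<And>i. 0 \<le> A $ i $ i"
    and q: "q v* A = (\<chi> j. - 1)" and nq: "(\<Sum>i\<in>UNIV. \<bar>q $ i\<bar>) \<le> 9 / 5"
  shows "0 < q $ i"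
proof -
  have eq: "1 + A $ k $ k * q $ k + (\<Sum>j\<in>UNIV - {k}. A $ j $ k * q $ j) = 0" for k
  proof -
    have "(\<Sum>j\<in>UNIV. A $ j $ k * q $ j) = - 1"
      using arg_cong[OF q, of "\<lambda>v. v $ k"] by (simp add: vector_matrix_mult_def mult.commute)
    then show ?thesis by (simp add: sum.remove[of UNIV k])
  qed
  have pos_ge: "1 \<le> (\<Sum>j\<in>UNIV - {k}. max 0 (q $ j))" if "0 \<le> q $ k" for k
  proof -
    have "- (A $ j $ k * q $ j) \<le> max 0 (q $ j)" if "j \<in> UNIV - {k}" for j
    proof (cases "0 \<le> q $ j")
      case True
      then show ?thesis using B[of j k] mult_right_mono[of "- (A $ j $ k)" 1 "q $ j"] by auto
    next
      case False
      then show ?thesis using off[of j k] that by (simp add: mult_nonpos_nonpos)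
    qed
    then have "- (\<Sum>j\<in>UNIV - {k}. A $ j $ k * q $ j) \<le> (\<Sum>j\<in>UNIV - {k}. max 0 (q $ j))"
      unfolding sum_negf[symmetric] by (rule sum_mono)
    moreover have "0 \<le> A $ k $ k * q $ k" using dg that by simp
    ultimately show ?thesis using eq[of k] by linarith
  qed
  have neg_le: "q $ k \<le> - 1" if "\<And>j. q $ j \<le> 0" for k
  proof -
    have "0 \<le> (\<Sum>j\<in>UNIV - {k}. A $ j $ k * q $ j)"
      using off that by (intro sum_nonneg mult_nonpos_nonpos) auto
    then have "1 \<le> A $ k $ k * (- q $ k)" using eq[of k] by simp
    also have "\<dots> \<le> 1 * (- q $ k)"
      using B[of k k] that[of k] by (intro mult_right_mono) auto
    finally show ?thesis by simp
  qed
  have U: "(UNIV :: 3 set) - {1} = {2,3}" "(UNIV :: 3 set) - {2} = {1,3}" "(UNIV :: 3 set) - {3} = {1,2}"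
    using exhaust_3 by fastforce+
  have "0 \<le> q $ 1 \<Longrightarrow> 1 \<le> max 0 (q $ 2) + max 0 (q $ 3)"
    "0 \<le> q $ 2 \<Longrightarrow> 1 \<le> max 0 (q $ 1) + max 0 (q $ 3)"
    "0 \<le> q $ 3 \<Longrightarrow> 1 \<le> max 0 (q $ 1) + max 0 (q $ 2)"
    using pos_ge[of 1] pos_ge[of 2] pos_ge[of 3] by (simp_all add: U)
  moreover have "q $ 1 \<le> 0 \<Longrightarrow> q $ 2 \<le> 0 \<Longrightarrow> q $ 3 \<le> 0 \<Longrightarrow> q $ 1 \<le> - 1 \<and> q $ 2 \<le> - 1"
    using neg_le by (metis exhaust_3)
  moreover have "\<bar>q $ 1\<bar> + \<bar>q $ 2\<bar> + \<bar>q $ 3\<bar> \<le> 9 / 5" using nq by (simp add: sum_3)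
  ultimately have "0 < q $ 1 \<and> 0 < q $ 2 \<and> 0 < q $ 3"
    by (cases "q $ 1 \<le> 0"; cases "q $ 2 \<le> 0"; cases "q $ 3 \<le> 0";
        simp add: max_def abs_if split: if_splits)
  then show ?thesis using exhaust_3[of i] by auto
qed

text \<open>
  The \<open>k\<close>-th equation of \<open>q v* A = - 1\<close>, written with the deficits \<open>1 + A $ i $ k\<close> of the off-diagonal
  entries from their least value \<open>-1\<close>. For \<open>q > 0\<close> it bounds the diagonal entry from above, with equality only
  if the deficits vanish.
\<close>

lemma diagonal_equation:
  fixes A :: "real ^ 'n ^ 'n"
  assumes q: "q v* A = (\<chi> j. - 1)"
  shows "A $ k $ k * q $ k = (\<Sum>i\<in>UNIV. q $ i) - 1 - q $ k - (\<Sum>i\<in>UNIV - {k}. q $ i * (1 + A $ i $ k))"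
proof -
  have "- 1 = (q v* A) $ k" by (simp add: q)
  also have "\<dots> = (\<Sum>i\<in>UNIV. A $ i $ k * q $ i)" by (simp add: vector_matrix_mult_def mult.commute)
  also have "\<dots> = A $ k $ k * q $ k + (\<Sum>i\<in>UNIV - {k}. A $ i $ k * q $ i)"
    by (simp add: sum.remove)
  finally have "A $ k $ k * q $ k = - 1 - (\<Sum>i\<in>UNIV - {k}. A $ i $ k * q $ i)" by simp
  moreover have "(\<Sum>i\<in>UNIV. q $ i) = q $ k + (\<Sum>i\<in>UNIV - {k}. q $ i)"
    by (simp add: sum.remove)
  ultimately show ?thesis by (simp add: algebra_simps sum.distrib)
qed

text \<open>
  Test with \<open>y = q - \<tau> e_k\<close>. Column \<open>j\<close> gives \<open>- 1 - \<tau> * A $ k $ j\<close>, which for \<open>j \<noteq> k\<close> has absolute value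
  at most \<open>max 1 (\<tau> - 1)\<close>. As long as \<open>\<tau> - 1\<close> stays below \<open>5/9\<close> of the norm of \<open>y\<close>, that is, for \<open>\<tau> < t\<close> with
  \<open>4 * t = 9 + 5 * K - 10 * q $ k\<close>, only column \<open>k\<close> can be large enough, which bounds \<open>A $ k $ k\<close> from below.
  The claim, which is \<open>t * (1 - A $ k $ k) \<le> 2\<close>, is the limit \<open>\<tau> \<rightarrow> t\<close>.
\<close>

lemma diagonal_lower_bound:
  fixes A :: "real ^ 'n ^ 'n"
  assumes N: "norming A" and B: "\<And>i j. \<bar>A $ i $ j\<bar> \<le> 1"
    and off: "\<And>i j. i \<noteq> j \<Longrightarrow> A $ i $ j \<le> 0" and dg: "0 \<le> A $ k $ k"
    and q: "q v* A = (\<chi> j. - 1)" and q0: "\<And>i. 0 \<le> q $ i"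
    and K: "K = (\<Sum>i\<in>UNIV. q $ i)" "K \<le> 9 / 5"
  shows "(9 + 5 * K - 10 * q $ k) * (1 - A $ k $ k) \<le> 8"
proof (rule ccontr)
  assume neg: "\<not> ?thesis"
  define t where "t = (9 + 5 * K - 10 * q $ k) / 4"
  define L where "L = t * (1 - A $ k $ k) - 2"
  define \<tau> where "\<tau> = t - L / 2"
  have Lpos: "L > 0" using neg by (simp add: L_def t_def)
  have K_split: "K = q $ k + (\<Sum>i\<in>UNIV - {k}. q $ i)"
    unfolding K by (simp add: sum.remove)
  have "q $ k \<le> K" unfolding K_split using q0 by (simp add: sum_nonneg)
  then have "t \<ge> 0" using K(2) q0[of k] by (simp add: t_def)
  then have Lt: "L \<le> t"
    using dg mult_left_mono[of "1 - A $ k $ k" 1 t] by (simp add: L_def)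
  then have tau: "0 \<le> \<tau>" "\<tau> < t" using Lpos \<open>t \<ge> 0\<close> by (auto simp: \<tau>_def)
  define y where "y = q - \<tau> *\<^sub>R axis k 1"
  have yA: "(y v* A) $ j = - 1 - \<tau> * A $ k $ j" for j
  proof -
    have "y v* A = q v* A - \<tau> *\<^sub>R (axis k 1 v* A)"
      unfolding y_def by (simp add: linear_diff[OF linear_vector_matrix_mult] linear_scale[OF linear_vector_matrix_mult])
    then show ?thesis by (simp add: q axis_vector_matrix_mult)
  qed
  have ynorm: "K - 2 * q $ k + \<tau> \<le> (\<Sum>i\<in>UNIV. \<bar>y $ i\<bar>)"
  proof -
    have "(\<Sum>i\<in>UNIV. \<bar>y $ i\<bar>) = \<bar>q $ k - \<tau>\<bar> + (\<Sum>i\<in>UNIV - {k}. \<bar>y $ i\<bar>)"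
      by (simp add: sum.remove[of UNIV k] y_def)
    also have "(\<Sum>i\<in>UNIV - {k}. \<bar>y $ i\<bar>) = (\<Sum>i\<in>UNIV - {k}. q $ i)"
      by (rule sum.cong) (auto simp: y_def axis_def q0)
    finally show ?thesis using K_split by linarith
  qed
  obtain j where j: "5 / 9 * (\<Sum>i\<in>UNIV. \<bar>y $ i\<bar>) \<le> \<bar>(y v* A) $ j\<bar>"
    using normingD[OF N] .
  then have j': "5 / 9 * (K - 2 * q $ k + \<tau>) \<le> \<bar>1 + \<tau> * A $ k $ j\<bar>"
    unfolding yA using ynorm abs_minus_cancel[of "1 + \<tau> * A $ k $ j"] by simp
  have t_eq: "5 / 9 * (K - 2 * q $ k) = 4 / 9 * t - 1" by (simp add: t_def field_simps)
  \<comment> \<open>At \<open>\<tau> = t\<close> column \<open>k\<close> would fall short of the required size by \<open>L\<close>; going back by \<open>L / 2\<close> keeps part of the gap.\<close>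
  have bound_diag: "1 + \<tau> * A $ k $ k < 5 / 9 * (K - 2 * q $ k + \<tau>)"
  proof -
    have "5 / 9 * (K - 2 * q $ k + \<tau>) = 4 / 9 * t - 1 + 5 / 9 * \<tau>"
      using t_eq by simp
    then have "5 / 9 * (K - 2 * q $ k + \<tau>) - (1 + \<tau> * A $ k $ k) = L - L / 2 * (5 / 9 - A $ k $ k)"
      by (simp add: \<tau>_def L_def field_simps)
    moreover have "L / 2 * (5 / 9 - A $ k $ k) \<le> L / 2 * (5 / 9)"
      using Lpos dg by (intro mult_left_mono) auto
    ultimately show ?thesis using Lpos by linarith
  qed
  have d0: "0 \<le> \<tau> * A $ k $ k" using tau dg by simp
  show False
  proof (cases "j = k")
    case True
    then show False using j' bound_diag d0 by simp
  next
    case False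
    then have "- \<tau> \<le> \<tau> * A $ k $ j" "\<tau> * A $ k $ j \<le> 0"
      using tau(1) off[of k j] B[of k j] mult_left_mono[of "-1" "A $ k $ j" \<tau>]
      by (auto simp: mult_nonneg_nonpos abs_le_iff)
    then have "\<bar>1 + \<tau> * A $ k $ j\<bar> \<le> max 1 (\<tau> - 1)" by linarith
    then show False
      using j' bound_diag d0 t_eq tau(2) by (auto simp: max_def split: if_splits)
  qed
qed

text \<open>
  By concavity, \<open>20 * x * (K - x)\<close> is larger on the open interval from \<open>K / 3\<close> to \<open>2 * K / 3\<close> than at its end
  points, where it already reaches the bound because \<open>K \<le> 9 / 5\<close>. Since \<open>K - 1 < 2 * K / 3\<close>, no coordinate
  lies beyond \<open>K / 3\<close>.
\<close>

lemma coordinates_eq_three_fifths: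
  fixes a b c K :: real
  assumes K: "K = a + b + c" "1 \<le> K" "K \<le> 9 / 5"
    and h: "\<And>x. x \<in> {a,b,c} \<Longrightarrow> 20 * x * (K - x) \<le> (K - 1) * (9 + 5 * K)"
    and ub: "\<And>x. x \<in> {a,b,c} \<Longrightarrow> x \<le> K - 1"
  shows "a = 3 / 5 \<and> b = 3 / 5 \<and> c = 3 / 5"
proof -
  \<comment> \<open>\<open>40 / 9 * K^2\<close> is the value of \<open>20 * x * (K - x)\<close> at \<open>x = K / 3\<close>.\<close>
  have hK: "(K - 1) * (9 + 5 * K) = 40 / 9 * K\<^sup>2 + 5 / 9 * (K - 9 / 5) * (K + 9)"
    by (simp add: field_simps power2_eq_square)
  have le: "x \<le> K / 3" if x: "x \<in> {a,b,c}" for x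
  proof (rule ccontr)
    assume "\<not> x \<le> K / 3"
    then have "0 < (x - K / 3) * (2 * K / 3 - x)" using ub[OF x] K by (intro mult_pos_pos) auto
    then have "20 * x * (K - x) > 40 / 9 * K\<^sup>2" by (simp add: field_simps power2_eq_square)
    moreover have "5 / 9 * (K - 9 / 5) * (K + 9) \<le> 0"
      using K(2,3) mult_nonneg_nonneg[of "9 / 5 - K" "K + 9"] by (simp add: algebra_simps)
    ultimately show False using h[OF x] hK by linarith
  qed
  have "a \<le> K / 3" "b \<le> K / 3" "c \<le> K / 3" by (rule le; simp)+
  then have eq: "a = K / 3" "b = K / 3" "c = K / 3" using K(1) by linarith+
  then have "20 * (K / 3) * (K - K / 3) \<le> (K - 1) * (9 + 5 * K)" using h[of a, unfolded eq(1)] by simp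
  then have "0 \<le> (K - 9 / 5) * (K + 9)" unfolding hK by (simp add: field_simps power2_eq_square)
  then have "K \<ge> 9 / 5" using K(2) by (auto simp: zero_le_mult_iff)
  then show ?thesis using eq K(3) by simp
qed

text \<open>
  The upper and lower bounds for the diagonal entries leave only \<open>q = (3/5, 3/5, 3/5)\<close>. There the lower
  bound \<open>1/3\<close> meets the upper bound, which is attained only if all off-diagonal entries are \<open>-1\<close>.
\<close>

lemma norming_sign_pattern:
  fixes A :: "real ^ 3 ^ 3"
  assumes N: "norming A" and B: "\<And>i j. \<bar>A $ i $ j\<bar> \<le> 1"
    and off: "\<And>i j. i \<noteq> j \<Longrightarrow> A $ i $ j \<le> 0" and dg: "\<And>i. 0 \<le> A $ i $ i"
  shows "A $ i $ j = (if i = j then 1 / 3 else - 1)"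
proof -
  obtain q where q: "q v* A = (\<chi> j. - 1)" using norming_surj[OF N] .
  have nq: "(\<Sum>i\<in>UNIV. \<bar>q $ i\<bar>) \<le> 9 / 5"
  proof -
    obtain j where "5 / 9 * (\<Sum>i\<in>UNIV. \<bar>q $ i\<bar>) \<le> \<bar>(q v* A) $ j\<bar>" using normingD[OF N] .
    then show ?thesis by (simp add: q)
  qed
  have pos: "0 < q $ i" for i by (rule solution_pos[OF B off dg q nq])
  define K where "K = (\<Sum>i\<in>UNIV. q $ i)"
  have K: "K \<le> 9 / 5" using nq pos by (simp add: K_def less_imp_le)
  have upper: "A $ k $ k * q $ k = K - 1 - q $ k - (\<Sum>i\<in>UNIV - {k}. q $ i * (1 + A $ i $ k))" for k
    unfolding K_def by (rule diagonal_equation[OF q])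
  have gap: "0 \<le> q $ i * (1 + A $ i $ j)" for i j
    using pos[of i] B[of i j] by (intro mult_nonneg_nonneg) auto
  then have gaps: "0 \<le> (\<Sum>i\<in>UNIV - {k}. q $ i * (1 + A $ i $ k))" for k
    by (simp add: sum_nonneg)
  have lower: "(9 + 5 * K - 10 * q $ k) * (1 - A $ k $ k) \<le> 8" for k
    using diagonal_lower_bound[OF N B off dg q _ K_def K] pos by (simp add: less_imp_le)
  have ub: "q $ k \<le> K - 1" for k
    using upper[of k] gaps[of k] mult_nonneg_nonneg[OF dg[of k] less_imp_le[OF pos[of k]]] by linarith
  have quad: "20 * q $ k * (K - q $ k) \<le> (K - 1) * (9 + 5 * K)" for k
  proof -
    have f: "0 \<le> 9 + 5 * K - 10 * q $ k" using K ub[of k] by simp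
    \<comment> \<open>Eliminate \<open>A $ k $ k\<close> between its lower bound and its upper bound.\<close>
    have "(9 + 5 * K - 10 * q $ k) * (2 * q $ k - (K - 1)) \<le>
        (9 + 5 * K - 10 * q $ k) * (q $ k * (1 - A $ k $ k))"
      using upper[of k] gaps[of k] by (intro mult_left_mono f) (simp add: algebra_simps)
    also have "\<dots> = q $ k * ((9 + 5 * K - 10 * q $ k) * (1 - A $ k $ k))" by simp
    also have "\<dots> \<le> q $ k * 8"
      using lower pos by (intro mult_left_mono) (simp_all add: less_imp_le)
    finally show ?thesis by (simp add: algebra_simps)
  qed
  have "q $ 1 = 3 / 5 \<and> q $ 2 = 3 / 5 \<and> q $ 3 = 3 / 5"
  proof (rule coordinates_eq_three_fifths)
    show "K = q $ 1 + q $ 2 + q $ 3" by (simp add: K_def sum_3)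
    show "1 \<le> K" using pos[of 1] ub[of 1] by simp
  qed (use K quad ub in auto)
  then have q35: "q $ k = 3 / 5" for k using exhaust_3[of k] by auto
  then have K95: "K = 9 / 5" by (simp add: K_def sum_3)
  have ge: "1 / 3 \<le> A $ k $ k" for k
    using lower[of k] unfolding q35[of k] K95 by simp
  have d: "A $ k $ k = 1 / 3" and g: "(\<Sum>i\<in>UNIV - {k}. q $ i * (1 + A $ i $ k)) = 0" for k
    using ge[of k] upper[of k] gaps[of k] unfolding q35[of k] K95 by linarith+
  have "A $ i $ j = - 1" if "i \<noteq> j"
  proof -
    have "\<forall>i\<in>UNIV - {j}. q $ i * (1 + A $ i $ j) = 0"
      using g[of j] gap by (simp only: sum_nonneg_eq_0_iff finite)
    then have "q $ i * (1 + A $ i $ j) = 0" using that by blast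
    then show ?thesis using pos[of i] by simp
  qed
  then show ?thesis using d by simp
qed

section \<open>The sign pattern\<close>

lemma ex_3: "(\<exists>i::3. P i) \<longleftrightarrow> P 1 \<or> P 2 \<or> P 3"
  using forall_3[of "\<lambda>i. \<not> P i"] by blast

text \<open>
  View \<open>(x j, y j)\<close> as the type of column \<open>j\<close>, an element of the Klein four-group. The hypotheses say that
  none of its three non-trivial characters is constant on the columns. So the three types are
  distinct: otherwise the column types would be at most two elements, and some non-trivial character
  is constant on them. Exactly one type, \<open>(a, b)\<close>, is missing, and the columns can be numbered by their
  difference from it.
\<close>

lemma distinct_column_types:
  fixes x y :: "3 \<Rightarrow> bool"
  assumes x: "\<exists>j. x j" "\<exists>j. \<not> x j" and y: "\<exists>j. y j" "\<exists>j. \<not> y j"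
    and xy: "\<exists>j. x j = y j" "\<exists>j. x j \<noteq> y j"
  obtains (ex) a b p1 p2 p3 where "p1 \<noteq> p2" "p1 \<noteq> p3" "p2 \<noteq> p3"
    "x p1 \<noteq> a" "y p1 \<noteq> b" "x p2 \<noteq> a" "y p2 = b" "x p3 = a" "y p3 \<noteq> b"
proof -
  define Q where "Q a b p1 p2 p3 \<longleftrightarrow>
    x p1 \<noteq> a \<and> y p1 \<noteq> b \<and> x p2 \<noteq> a \<and> y p2 = b \<and> x p3 = a \<and> y p3 \<noteq> b" for a b p1 p2 p3
  have "\<exists>a b. Q a b 1 2 3 \<or> Q a b 1 3 2 \<or> Q a b 2 1 3 \<or> Q a b 2 3 1 \<or> Q a b 3 1 2 \<or> Q a b 3 2 1"
    using assms unfolding ex_3 Q_def ex_bool_eq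
    by (cases "x 1"; cases "x 2"; cases "x 3"; cases "y 1"; cases "y 2"; cases "y 3"; simp)
  then obtain a b where
    ab: "Q a b 1 2 3 \<or> Q a b 1 3 2 \<or> Q a b 2 1 3 \<or> Q a b 2 3 1 \<or> Q a b 3 1 2 \<or> Q a b 3 2 1"
    by blast
  have *: thesis if "Q a b k l m" "k \<noteq> l" "k \<noteq> m" "l \<noteq> m" for k l m
    using that(1) unfolding Q_def by (elim conjE) (rule ex[OF that(2-4)])
  show thesis using ab by (elim disjE) (erule *; simp)+
qed

text \<open>
  Read \<open>s i j\<close> as ``entry \<open>(i, j)\<close> is negative''. After permuting the columns by \<open>p\<close>, negating the rows in \<open>r\<close>
  and the columns in \<open>c\<close>, exactly the off-diagonal entries are negative. The column types of the
  preceding lemma are the signs of rows 2 and 3 relative to row 1, which column negations do not change.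
\<close>

lemma column_signs_bool:
  fixes s :: "3 \<Rightarrow> 3 \<Rightarrow> bool"
  assumes "\<And>i k. i \<noteq> k \<Longrightarrow> (\<exists>j. s i j = s k j) \<and> (\<exists>j. s i j \<noteq> s k j)"
  obtains p and r c :: "3 \<Rightarrow> bool" where "bij p" "\<And>i j. s i (p j) = ((r i \<noteq> c j) \<noteq> (i \<noteq> j))"
proof -
  define u where "u i j = (s i j \<noteq> s 1 j)" for i j
  have "\<exists>j. u 2 j" "\<exists>j. \<not> u 2 j" "\<exists>j. u 3 j" "\<exists>j. \<not> u 3 j" "\<exists>j. u 2 j = u 3 j" "\<exists>j. u 2 j \<noteq> u 3 j"
  proof -
    have u23: "u 2 j = u 3 j \<longleftrightarrow> s 2 j = s 3 j" for j by (auto simp: u_def)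
    have "(2::3) \<noteq> 1" "(3::3) \<noteq> 1" "(2::3) \<noteq> 3" by simp_all
    note assms[OF this(1)] assms[OF this(2)] assms[OF this(3)]
    then show "\<exists>j. u 2 j" "\<exists>j. \<not> u 2 j" "\<exists>j. u 3 j" "\<exists>j. \<not> u 3 j"
      "\<exists>j. u 2 j = u 3 j" "\<exists>j. u 2 j \<noteq> u 3 j"
      unfolding u23 unfolding u_def not_not by blast+
  qed
  then obtain r2 r3 p1 p2 p3 where *: "p1 \<noteq> p2" "p1 \<noteq> p3" "p2 \<noteq> p3"
     "u 2 p1 \<noteq> r2" "u 3 p1 \<noteq> r3" "u 2 p2 \<noteq> r2" "u 3 p2 = r3" "u 2 p3 = r2" "u 3 p3 \<noteq> r3"
    by (rule distinct_column_types)
  define p :: "3 \<Rightarrow> 3" where "p j = (if j = 1 then p1 else if j = 2 then p2 else p3)" for j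
  define r where "r i = (if i = 1 then False else if i = 2 then r2 else r3)" for i :: 3
  \<comment> \<open>The column negations are dictated by row 1, which is not negated.\<close>
  define c where "c j = (s 1 (p j) \<noteq> (j \<noteq> 1))" for j
  have "inj p" using *(1-3) by (auto simp: inj_def p_def forall_3)
  then have "bij p" by (simp add: bij_def finite_UNIV_inj_surj)
  moreover have "s i (p j) = ((r i \<noteq> c j) \<noteq> (i \<noteq> j))" for i j
  proof -
    have u1: "\<not> u 1 j" for j by (simp add: u_def)
    have "\<forall>i j. u i (p j) \<longleftrightarrow> (r i \<noteq> ((i \<noteq> j) \<noteq> (j \<noteq> 1)))"
      unfolding forall_3 p_def r_def using *(4-9) by (cases r2; cases r3; simp add: u1)
    then have "u i (p j) \<longleftrightarrow> (r i \<noteq> ((i \<noteq> j) \<noteq> (j \<noteq> 1)))" by (elim allE)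
    then show ?thesis unfolding c_def u_def
      by (cases "s i (p j)"; cases "s 1 (p j)"; cases "r i"; simp)
  qed
  ultimately show thesis by (rule that)
qed

text \<open>
  Testing with \<open>e_i + e_k\<close> gives a column with \<open>\<bar>A $ i $ j + A $ k $ j\<bar> \<ge> 10 / 9 > 1\<close>. As entries are at
  most 1 in absolute value, the two entries have the same sign there. Likewise \<open>e_i - e_k\<close> gives opposite signs.
\<close>

lemma column_signs:
  fixes A :: "real ^ 3 ^ 3"
  assumes N: "norming A" and B: "\<And>i j. \<bar>A $ i $ j\<bar> \<le> 1"
  obtains p and r c :: "3 \<Rightarrow> bool" where "bij p" "\<And>i j. (A $ i $ p j < 0) = ((r i \<noteq> c j) \<noteq> (i \<noteq> j))"
proof (rule column_signs_bool[of "\<lambda>i j. A $ i $ j < 0"])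
  fix i k :: 3
  assume ik: "i \<noteq> k"
  have test: "\<exists>j. 10 / 9 \<le> \<bar>A $ i $ j + e * A $ k $ j\<bar>" if e: "\<bar>e\<bar> = 1" for e
  proof -
    define y where "y = axis i 1 + e *\<^sub>R axis k (1::real)"
    obtain j where "5 / 9 * (\<Sum>l\<in>UNIV. \<bar>y $ l\<bar>) \<le> \<bar>(y v* A) $ j\<bar>" using normingD[OF N] .
    moreover have "(\<Sum>l\<in>UNIV. \<bar>y $ l\<bar>) = (\<Sum>l\<in>UNIV. of_bool (l = i) + of_bool (l = k))"
      using ik e by (intro sum.cong) (auto simp: y_def axis_def)
    then have "(\<Sum>l\<in>UNIV. \<bar>y $ l\<bar>) = 2" by (simp add: sum.distrib of_bool_def)
    moreover have "(y v* A) $ j = A $ i $ j + e * A $ k $ j"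
      by (simp add: y_def linear_add[OF linear_vector_matrix_mult]
          linear_scale[OF linear_vector_matrix_mult] axis_vector_matrix_mult)
    ultimately show ?thesis by auto
  qed
  obtain j where "10 / 9 \<le> \<bar>A $ i $ j + A $ k $ j\<bar>" using test[of 1] by auto
  moreover obtain j' where "10 / 9 \<le> \<bar>A $ i $ j' - A $ k $ j'\<bar>" using test[of "-1"] by auto
  ultimately show "(\<exists>j. (A $ i $ j < 0) = (A $ k $ j < 0)) \<and> (\<exists>j. (A $ i $ j < 0) \<noteq> (A $ k $ j < 0))"
    using B[of i j] B[of k j] B[of i j'] B[of k j'] by (intro conjI exI[of _ j] exI[of _ j']) linarith+
qed (rule that)

section \<open>The orbit of the extremal matrix\<close>

definition flip_sign :: "bool \<Rightarrow> real" where
  "flip_sign b = (if b then - 1 else 1)"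

lemma flip_sign_simps [simp]:
  "flip_sign b * flip_sign b = 1" "flip_sign b * (flip_sign b * x) = x" "\<bar>flip_sign b\<bar> = 1" "flip_sign b \<noteq> 0"
  "flip_sign (\<not> b) = - flip_sign b" "flip_sign a = flip_sign b \<longleftrightarrow> a = b"
  by (auto simp: flip_sign_def)

text \<open>
  A normal form for the orbit of the extremal matrix. One permutation suffices, as simultaneous
  permutations of rows and columns fix that matrix.
\<close>

definition extremal_variant :: "(3 \<Rightarrow> 3) \<Rightarrow> (3 \<Rightarrow> bool) \<Rightarrow> (3 \<Rightarrow> bool) \<Rightarrow> real ^ 3 ^ 3" where
  "extremal_variant p r c = (\<chi> i j. flip_sign (r i) * flip_sign (c j) * (if i = p j then 1 / 3 else - 1))"

lemma extremal_matrix_nth: "extremal_matrix $ i $ j = (if i = j then 1 / 3 else - 1)"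
  using exhaust_3[of i] exhaust_3[of j] by (auto simp: extremal_matrix_def)

lemma signed_perm_orbit_negate_rows:
  assumes "B \<in> signed_perm_orbit A" "finite S"
  shows "(\<chi> i j. flip_sign (i \<in> S) * B $ i $ j) \<in> signed_perm_orbit A"
  using assms(2)
proof (induction S)
  case empty
  then show ?case using assms(1) by (simp add: flip_sign_def)
next
  case (insert k S)
  from signed_perm_orbit.negate_row[OF insert.IH, of k]
  show ?case
    by (rule back_subst[where P = "\<lambda>M. M \<in> _"]) (use insert.hyps in \<open>auto simp: vec_eq_iff flip_sign_def\<close>)
qed

lemma signed_perm_orbit_negate_columns:
  assumes "B \<in> signed_perm_orbit A" "finite S"
  shows "(\<chi> i j. flip_sign (j \<in> S) * B $ i $ j) \<in> signed_perm_orbit A"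
  using assms(2)
proof (induction S)
  case empty
  then show ?case using assms(1) by (simp add: flip_sign_def)
next
  case (insert k S)
  from signed_perm_orbit.negate_column[OF insert.IH, of k]
  show ?case
    by (rule back_subst[where P = "\<lambda>M. M \<in> _"]) (use insert.hyps in \<open>auto simp: vec_eq_iff flip_sign_def\<close>)
qed

lemma extremal_variant_in_orbit:
  assumes "bij p"
  shows "extremal_variant p r c \<in> signed_perm_orbit extremal_matrix"
proof -
  have "p permutes UNIV" using bij_imp_permutes[of p UNIV] assms by simp
  from signed_perm_orbit.permute_columns[OF signed_perm_orbit.base this]
  have "(\<chi> i j. flip_sign (j \<in> Collect c) * (\<chi> i j. flip_sign (i \<in> Collect r) *
          (\<chi> i j. extremal_matrix $ i $ p j) $ i $ j) $ i $ j) \<in> signed_perm_orbit extremal_matrix"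
    by (intro signed_perm_orbit_negate_rows signed_perm_orbit_negate_columns) auto
  then show ?thesis
    by (rule back_subst[where P = "\<lambda>M. M \<in> _"])
      (simp add: vec_eq_iff extremal_variant_def extremal_matrix_nth)
qed

lemma orbit_extremal_variant:
  assumes "B \<in> signed_perm_orbit extremal_matrix"
  shows "\<exists>p r c. bij p \<and> B = extremal_variant p r c"
  using assms
proof induction
  case base
  have "extremal_matrix = extremal_variant id (\<lambda>_. False) (\<lambda>_. False)"
    by (simp add: vec_eq_iff extremal_variant_def extremal_matrix_nth flip_sign_def)
  then show ?case using bij_id by blast
next
  case (permute_rows B \<pi>)
  then obtain p r c where "bij p" and B: "B = extremal_variant p r c" by blast
  have \<pi>: "bij \<pi>" using permute_rows.hyps(2) by (rule permutes_bij)
  have "(\<chi> i j. B $ \<pi> i $ j) = extremal_variant (inv \<pi> \<circ> p) (r \<circ> \<pi>) c"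
    using \<pi> by (auto simp: B vec_eq_iff extremal_variant_def bij_inv_eq_iff)
  moreover have "bij (inv \<pi> \<circ> p)" using \<pi> \<open>bij p\<close> by (simp add: bij_comp bij_imp_bij_inv)
  ultimately show ?case by blast
next
  case (permute_columns B \<pi>)
  then obtain p r c where "bij p" and B: "B = extremal_variant p r c" by blast
  have "(\<chi> i j. B $ i $ \<pi> j) = extremal_variant (p \<circ> \<pi>) r (c \<circ> \<pi>)"
    by (simp add: B vec_eq_iff extremal_variant_def)
  moreover have "bij (p \<circ> \<pi>)"
    using permutes_bij[OF permute_columns.hyps(2)] \<open>bij p\<close> by (simp add: bij_comp)
  ultimately show ?case by blast
next
  case (negate_row B k)
  then obtain p r c where "bij p" and B: "B = extremal_variant p r c" by blast
  have "(\<chi> i j. if i = k then - (B $ i $ j) else B $ i $ j) = extremal_variant p (r(k := \<not> r k)) c"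
    by (simp add: B vec_eq_iff extremal_variant_def)
  then show ?case using \<open>bij p\<close> by blast
next
  case (negate_column B k)
  then obtain p r c where "bij p" and B: "B = extremal_variant p r c" by blast
  have "(\<chi> i j. if j = k then - (B $ i $ j) else B $ i $ j) = extremal_variant p r (c(k := \<not> c k))"
    by (simp add: B vec_eq_iff extremal_variant_def)
  then show ?case using \<open>bij p\<close> by blast
qed

text \<open>
  The position of the entries of absolute value \<open>1/3\<close> determines \<open>p\<close>. The signs determine \<open>r\<close> and \<open>c\<close> up to
  negating everything in both, which fixing \<open>r 1\<close> excludes.
\<close>

lemma extremal_variant_inject:
  assumes eq: "extremal_variant p r c = extremal_variant p' r' c'" and r1: "r 1 = r' 1"
  shows "p = p' \<and> r = r' \<and> c = c'"
proof -
  have e: "flip_sign (r i) * flip_sign (c j) * (if i = p j then 1 / 3 else - 1) =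
      flip_sign (r' i) * flip_sign (c' j) * (if i = p' j then 1 / 3 else - 1)" for i j
    using arg_cong[OF eq, of "\<lambda>M. M $ i $ j"] by (simp add: extremal_variant_def)
  have p: "p = p'"
  proof
    fix j
    show "p j = p' j" using arg_cong[OF e[of "p j" j], of abs] by (auto simp: abs_mult split: if_splits)
  qed
  have e': "flip_sign (r i) * flip_sign (c j) = flip_sign (r' i) * flip_sign (c' j)" for i j
    using e[of i j] p by (auto split: if_splits)
  have "c j = c' j" for j using e'[of 1 j] r1 by simp
  moreover from this have "r i = r' i" for i using e'[of i 1] by simp
  ultimately show ?thesis using p by blast
qed

text \<open>
  By the normal form with \<open>r 1 = False\<close> the count is \<open>3! * 2^2 * 2^3\<close>.
\<close>

lemma card_orbit_extremal: "card (signed_perm_orbit extremal_matrix) = 192"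
proof -
  define row :: "bool \<times> bool \<Rightarrow> 3 \<Rightarrow> bool" where
    "row = (\<lambda>(a, b) i. if i = 1 then False else if i = 2 then a else b)"
  define F where "F = (\<lambda>(p, ab, c). extremal_variant p (row ab) c)"
  define D where "D = {p :: 3 \<Rightarrow> 3. p permutes UNIV} \<times> (UNIV :: ((bool \<times> bool) \<times> (3 \<Rightarrow> bool)) set)"
  have row: "row ab = row ab' \<longleftrightarrow> ab = ab'" for ab ab'
    by (auto simp: row_def fun_eq_iff forall_3 split: prod.splits)
  have row1: "row ab 1 = False" for ab by (simp add: row_def split: prod.splits)
  have "inj_on F D"
    by (rule inj_onI) (auto simp: F_def row1 row dest!: extremal_variant_inject)
  moreover have "F ` D = signed_perm_orbit extremal_matrix"
  proof (intro equalityI subsetI)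
    fix B assume "B \<in> F ` D"
    then show "B \<in> signed_perm_orbit extremal_matrix"
      by (auto simp: F_def D_def intro!: extremal_variant_in_orbit dest: permutes_bij)
  next
    fix B assume "B \<in> signed_perm_orbit extremal_matrix"
    then obtain p r c where p: "bij p" and B: "B = extremal_variant p r c"
      using orbit_extremal_variant by blast
    \<comment> \<open>Negating all rows and all columns changes nothing, so row 1 may be taken unnegated.\<close>
    have "B = extremal_variant p (\<lambda>i. r i \<noteq> r 1) (\<lambda>j. c j \<noteq> r 1)"
      by (auto simp: B vec_eq_iff extremal_variant_def flip_sign_def)
    also have "(\<lambda>i. r i \<noteq> r 1) = row (r 2 \<noteq> r 1, r 3 \<noteq> r 1)"
      by (auto simp: row_def fun_eq_iff forall_3)
    finally have "B = F (p, (r 2 \<noteq> r 1, r 3 \<noteq> r 1), (\<lambda>j. c j \<noteq> r 1))"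
      by (simp add: F_def)
    then show "B \<in> F ` D" using p bij_imp_permutes[of p UNIV] by (auto simp: D_def)
  qed
  moreover have "card D = 192"
    by (simp add: D_def card_cartesian_product card_permutations[of UNIV 3] fact_numeral
      card_fun card_UNIV_bool flip: UNIV_Times_UNIV)
  ultimately show ?thesis by (metis card_image)
qed

text \<open>
  Signed permutations preserve both hypotheses, so the general case reduces to the fixed sign pattern.
\<close>

lemma norming_extremal:
  fixes A :: "real ^ 3 ^ 3"
  assumes N: "norming A" and B: "\<And>i j. \<bar>A $ i $ j\<bar> \<le> 1"
  obtains p r c where "bij p" "A = extremal_variant p r c"
proof (rule column_signs[OF N B])
  fix p and r c :: "3 \<Rightarrow> bool"
  assume p: "bij p" and s: "\<And>i j. (A $ i $ p j < 0) = ((r i \<noteq> c j) \<noteq> (i \<noteq> j))"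
  define A' :: "real ^ 3 ^ 3" where "A' = (\<chi> i j. flip_sign (r i) * flip_sign (c j) * A $ i $ p j)"
  have A': "A' $ i $ j = (if i = j then 1 / 3 else - 1)" for i j
  proof (rule norming_sign_pattern)
    show "norming A'"
      unfolding norming_def
    proof
      fix y
      \<comment> \<open>Row signs are absorbed into the test vector; column signs vanish in the absolute value.\<close>
      define y' where "y' = (\<chi> i. flip_sign (r i) * y $ i)"
      obtain j where j: "5 / 9 * (\<Sum>i\<in>UNIV. \<bar>y' $ i\<bar>) \<le> \<bar>(y' v* A) $ j\<bar>" using normingD[OF N] .
      obtain j' where j': "j = p j'" using p by (meson bij_pointE)
      have "(y v* A') $ j' = flip_sign (c j') * (y' v* A) $ j"
        by (simp add: j' A'_def y'_def vector_matrix_mult_def sum_distrib_left mult_ac)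
      then have "\<bar>(y v* A') $ j'\<bar> = \<bar>(y' v* A) $ j\<bar>" by (simp add: abs_mult)
      moreover have "(\<Sum>i\<in>UNIV. \<bar>y' $ i\<bar>) = (\<Sum>i\<in>UNIV. \<bar>y $ i\<bar>)"
        by (simp add: y'_def abs_mult)
      ultimately show "\<exists>j. 5 / 9 * (\<Sum>i\<in>UNIV. \<bar>y $ i\<bar>) \<le> \<bar>(y v* A') $ j\<bar>"
        using j by (intro exI[of _ j']) simp
    qed
    show "\<bar>A' $ i $ j\<bar> \<le> 1" for i j using B by (simp add: A'_def abs_mult)
    show "A' $ i $ j \<le> 0" if "i \<noteq> j" for i j
      using s[of i j] that by (auto simp: A'_def flip_sign_def)
    show "0 \<le> A' $ i $ i" for i using s[of i i] by (auto simp: A'_def flip_sign_def)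
  qed
  have "A $ i $ p j = flip_sign (r i) * flip_sign (c j) * (if i = j then 1 / 3 else - 1)" for i j
    using A'[of i j] by (auto simp: A'_def flip_sign_def split: if_splits)
  then have "A $ i $ j = flip_sign (r i) * flip_sign (c (inv p j)) * (if i = inv p j then 1 / 3 else - 1)" for i j
    using bij_is_surj[OF p] by (metis surj_f_inv_f)
  then have "A = extremal_variant (inv p) r (c \<circ> inv p)"
    by (simp add: vec_eq_iff extremal_variant_def)
  then show thesis using that bij_imp_bij_inv[OF p] by blast
qed

lemma operator_extremal:
  fixes T :: "real ^ 3 \<Rightarrow> real ^ 3"
  assumes T: "linear T"
    and inner: "(\<lambda>x. (5 / 9) *\<^sub>R x) ` unit_cube \<subseteq> T ` cross_polytope"
    and outer: "T ` cross_polytope \<subseteq> unit_cube"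
  obtains p r c where "bij p" "matrix T = extremal_variant p r c"
proof (rule norming_extremal)
  show "norming (matrix T)" using norming_matrix[OF T inner] .
  show "\<bar>matrix T $ i $ j\<bar> \<le> 1" for i j
    using outer by (intro matrix_entries_bounded) simp_all
qed (rule that)

section \<open>Removing the translations\<close>

lemma unit_cube_minus: "x \<in> unit_cube \<Longrightarrow> - x \<in> unit_cube"
  by (auto simp: unit_cube_def minus_le_iff)

lemma cross_polytope_minus: "x \<in> cross_polytope \<Longrightarrow> - x \<in> cross_polytope"
  by (simp add: cross_polytope_def)

lemma convex_unit_cube: "convex (unit_cube :: (real ^ 'n) set)"
proof -
  have "(unit_cube :: (real ^ 'n) set) = cbox (\<chi> i. - 1) (\<chi> i. 1)" by (auto simp: unit_cube_def mem_box_cart)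
  then show ?thesis by (metis convex_box(1))
qed

lemma convex_cross_polytope: "convex cross_polytope"
proof (rule convexI)
  fix x y :: "real ^ 'n" and u v :: real
  assume x: "x \<in> cross_polytope" and y: "y \<in> cross_polytope" and uv: "0 \<le> u" "0 \<le> v" "u + v = 1"
  have "(\<Sum>i\<in>UNIV. \<bar>(u *\<^sub>R x + v *\<^sub>R y) $ i\<bar>) \<le> (\<Sum>i\<in>UNIV. u * \<bar>x $ i\<bar> + v * \<bar>y $ i\<bar>)"
    using uv by (intro sum_mono) (auto intro!: order_trans[OF abs_triangle_ineq] simp: abs_mult)
  also have "\<dots> = u * (\<Sum>i\<in>UNIV. \<bar>x $ i\<bar>) + v * (\<Sum>i\<in>UNIV. \<bar>y $ i\<bar>)"
    by (simp add: sum.distrib sum_distrib_left)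
  also have "\<dots> \<le> u * 1 + v * 1"
    using x y uv by (intro add_mono mult_left_mono) (auto simp: cross_polytope_def)
  finally show "u *\<^sub>R x + v *\<^sub>R y \<in> cross_polytope" using uv by (simp add: cross_polytope_def)
qed

text \<open>
  If \<open>K + w\<close> lies in \<open>L\<close>, then so does \<open>K - w\<close> by symmetry, and each \<open>x\<close> in \<open>K\<close> is the midpoint of \<open>x + w\<close> and \<open>x - w\<close>.
\<close>

lemma symmetric_translate_subset:
  fixes K L :: "'a :: real_vector set"
  assumes K: "\<And>x. x \<in> K \<Longrightarrow> - x \<in> K" and L: "convex L" "\<And>x. x \<in> L \<Longrightarrow> - x \<in> L"
    and sub: "(\<lambda>x. x + u) ` K \<subseteq> (\<lambda>x. x + v) ` L"
  shows "K \<subseteq> L"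
proof
  fix x assume "x \<in> K"
  have mem: "z + (u - v) \<in> L" if "z \<in> K" for z
  proof -
    have "z + u \<in> (\<lambda>x. x + v) ` L" using sub that by blast
    then show ?thesis by (auto simp: algebra_simps)
  qed
  have "x + (u - v) \<in> L" "- (- x + (u - v)) \<in> L"
    using mem[OF \<open>x \<in> K\<close>] L(2)[OF mem[OF K[OF \<open>x \<in> K\<close>]]] by auto
  then have "(1 / 2) *\<^sub>R (x + (u - v)) + (1 / 2) *\<^sub>R (- (- x + (u - v))) \<in> L"
    by (intro convexD[OF L(1)]) auto
  moreover have "(1 / 2) *\<^sub>R (x + (u - v)) + (1 / 2) *\<^sub>R (- (- x + (u - v))) = x"
    by (simp add: algebra_simps flip: scaleR_add_left)
  ultimately show "x \<in> L" by simp
qed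

lemma centered_inclusions:
  fixes T :: "real ^ 'n \<Rightarrow> real ^ 'n"
  assumes T: "linear T"
    and inner: "(\<lambda>x. x + u) ` unit_cube \<subseteq> T ` ((\<lambda>x. x + v) ` cross_polytope)"
    and outer: "T ` ((\<lambda>x. x + v) ` cross_polytope) \<subseteq> (\<lambda>x. r *\<^sub>R x) ` ((\<lambda>x. x + u) ` unit_cube)"
  shows "unit_cube \<subseteq> T ` cross_polytope" "T ` cross_polytope \<subseteq> (\<lambda>x. r *\<^sub>R x) ` unit_cube"
proof -
  have symT: "- x \<in> T ` cross_polytope" if "x \<in> T ` cross_polytope" for x
    using that by (auto simp flip: linear_neg[OF T] intro: imageI cross_polytope_minus)
  have symC: "- x \<in> (\<lambda>x. r *\<^sub>R x) ` unit_cube" if "x \<in> (\<lambda>x. r *\<^sub>R x) ` unit_cube" for x :: "real ^ 'n"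
    using that by (auto simp flip: scaleR_minus_right intro: imageI unit_cube_minus)
  have TL: "T ` ((\<lambda>x. x + v) ` cross_polytope) = (\<lambda>x. x + T v) ` (T ` cross_polytope)"
    by (simp add: image_image linear_add[OF T])
  have rC: "(\<lambda>x. r *\<^sub>R x) ` ((\<lambda>x. x + u) ` unit_cube) = (\<lambda>x. x + r *\<^sub>R u) ` ((\<lambda>x. r *\<^sub>R x) ` unit_cube)"
    by (simp add: image_image scaleR_add_right)
  show "unit_cube \<subseteq> T ` cross_polytope"
    using unit_cube_minus convex_linear_image[OF T convex_cross_polytope] symT inner[unfolded TL]
    by (rule symmetric_translate_subset)
  show "T ` cross_polytope \<subseteq> (\<lambda>x. r *\<^sub>R x) ` unit_cube"
    using symT convex_scaling[OF convex_unit_cube] symC outer[unfolded TL rC]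
    by (rule symmetric_translate_subset)
qed

section \<open>The distance\<close>

text \<open>
  The ratio \<open>9/5\<close> is attained. The extremal matrix is \<open>4/3 I - J\<close>, with \<open>J\<close> the all-ones matrix, so its
  inverse is again a combination of \<open>I\<close> and \<open>J\<close>.
\<close>

lemma extremal_matrix_inclusions:
  defines "T \<equiv> \<lambda>x :: real ^ 3. (9 / 5) *\<^sub>R (extremal_matrix *v x)"
  shows "linear T" "bij T"
    "unit_cube \<subseteq> T ` cross_polytope" "T ` cross_polytope \<subseteq> (\<lambda>x. (9 / 5) *\<^sub>R x) ` unit_cube"
proof -
  define S where "S x = (\<chi> i. (5 * x $ i - 3 * (x $ 1 + x $ 2 + x $ 3)) / 12)" for x :: "real ^ 3"
  have mult: "(extremal_matrix *v x) $ i = 4 / 3 * x $ i - (x $ 1 + x $ 2 + x $ 3)" for x i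
    using exhaust_3[of i] by (auto simp: matrix_vector_mult_def extremal_matrix_nth sum_3)
  show lin: "linear T" unfolding T_def by (intro linear_compose_scale_right matrix_vector_mul_linear)
  have TS: "T (S x) = x" for x
    by (simp add: T_def S_def vec_eq_iff mult field_simps)
  have ST: "S (T x) = x" for x
    by (simp add: T_def S_def vec_eq_iff mult field_simps)
  show "bij T" using TS ST by (intro bijI') metis+
  show "unit_cube \<subseteq> T ` cross_polytope"
  proof
    fix x :: "real ^ 3" assume "x \<in> unit_cube"
    then have x: "- 1 \<le> x $ i" "x $ i \<le> 1" for i by (auto simp: unit_cube_def)
    have "\<bar>5 * x $ 1 - 3 * (x $ 1 + x $ 2 + x $ 3)\<bar> + \<bar>5 * x $ 2 - 3 * (x $ 1 + x $ 2 + x $ 3)\<bar> +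
        \<bar>5 * x $ 3 - 3 * (x $ 1 + x $ 2 + x $ 3)\<bar> \<le> 12"
      using x[of 1] x[of 2] x[of 3] by (smt (verit))
    then have "S x \<in> cross_polytope"
      by (simp add: cross_polytope_def S_def sum_3 flip: add_divide_distrib del: diff_divide_distrib)
    then show "x \<in> T ` cross_polytope" using TS[of x] by (metis imageI)
  qed
  show "T ` cross_polytope \<subseteq> (\<lambda>x. (9 / 5) *\<^sub>R x) ` unit_cube"
  proof
    fix y assume "y \<in> T ` cross_polytope"
    then obtain x where x: "\<bar>x $ 1\<bar> + \<bar>x $ 2\<bar> + \<bar>x $ 3\<bar> \<le> 1" and y: "y = T x"
      by (auto simp: cross_polytope_def sum_3)
    have "extremal_matrix *v x \<in> unit_cube"
      unfolding unit_cube_def using x by (auto simp: mult forall_3)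
    then show "y \<in> (\<lambda>x. (9 / 5) *\<^sub>R x) ` unit_cube" by (auto simp: y T_def)
  qed
qed

text \<open>
  A smaller ratio leaves room to shrink \<open>T\<close> by \<open>5/9\<close> so that every entry becomes strictly less than 1 in
  absolute value, although the shrunken matrix must belong to the extremal orbit.
\<close>

lemma ratio_ge:
  fixes T :: "real ^ 3 \<Rightarrow> real ^ 3"
  assumes T: "linear T" and r: "0 < r"
    and inner: "unit_cube \<subseteq> T ` cross_polytope"
    and outer: "T ` cross_polytope \<subseteq> (\<lambda>x. r *\<^sub>R x) ` unit_cube"
  shows "9 / 5 \<le> r"
proof (rule ccontr)
  assume neg: "\<not> 9 / 5 \<le> r"
  define S where "S = (\<lambda>x. (5 / 9) *\<^sub>R T x)"
  have S: "linear S" unfolding S_def using T by (intro linear_compose_scale_right)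
  have bound: "\<bar>matrix S $ i $ j\<bar> < 1" for i j
    using matrix_entries_bounded[OF outer less_imp_le[OF r], of i j] neg
    by (simp add: S_def matrix_def abs_mult)
  have "norming (matrix S)"
    using inner by (intro norming_matrix S) (force simp: S_def)
  then obtain p q c where "bij p" and eq: "matrix S = extremal_variant p q c"
    using norming_extremal less_imp_le[OF bound] by blast
  obtain i where "i \<noteq> p 1" using exhaust_3[of "p 1"] by (metis zero_neq_one)
  then have "\<bar>matrix S $ i $ 1\<bar> = 1" unfolding eq by (simp add: extremal_variant_def abs_mult)
  then show False using bound[of i 1] by simp
qed

theorem theorem2p2:
  shows "banach_mazur_dist (unit_cube :: (real ^ 3) set) cross_polytope = 9 / 5 \<and>
    (\<forall>T :: real ^ 3 \<Rightarrow> real ^ 3.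
       linear T \<and>
       (\<lambda>x. (5 / 9) *\<^sub>R x) ` unit_cube \<subseteq> T ` cross_polytope \<and>
       T ` cross_polytope \<subseteq> unit_cube
       \<longrightarrow> matrix T \<in> signed_perm_orbit extremal_matrix) \<and>
    card (signed_perm_orbit extremal_matrix) = 192"
proof (intro conjI allI impI)
  show "banach_mazur_dist (unit_cube :: (real ^ 3) set) cross_polytope = 9 / 5"
    unfolding banach_mazur_dist_def
  proof (rule cInf_eq_minimum, goal_cases)
    case 1
    show ?case
      using extremal_matrix_inclusions
      by (intro CollectI conjI exI[of _ "\<lambda>x. (9 / 5) *\<^sub>R (extremal_matrix *v x)"]
          exI[of _ "0 :: real ^ 3"]) simp_all
  next
    case (2 r)
    then obtain T :: "real ^ 3 \<Rightarrow> real ^ 3" and u v where "0 < r" and T: "linear T"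
      and sub: "(\<lambda>x. x + u) ` unit_cube \<subseteq> T ` ((\<lambda>x. x + v) ` cross_polytope)"
        "T ` ((\<lambda>x. x + v) ` cross_polytope) \<subseteq> (\<lambda>x. r *\<^sub>R x) ` ((\<lambda>x. x + u) ` unit_cube)"
      by (elim CollectE conjE exE)
    show ?case by (rule ratio_ge[OF T \<open>0 < r\<close> centered_inclusions[OF T sub]])
  qed
  show "matrix T \<in> signed_perm_orbit extremal_matrix"
    if "linear T \<and> (\<lambda>x. (5 / 9) *\<^sub>R x) ` unit_cube \<subseteq> T ` cross_polytope \<and>
       T ` cross_polytope \<subseteq> unit_cube" for T :: "real ^ 3 \<Rightarrow> real ^ 3"
  proof -
    from that have T: "linear T" "(\<lambda>x. (5 / 9) *\<^sub>R x) ` unit_cube \<subseteq> T ` cross_polytope"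
      "T ` cross_polytope \<subseteq> unit_cube" by blast+
    show ?thesis
      by (rule operator_extremal[OF T]) (simp add: extremal_variant_in_orbit)
  qed
  show "card (signed_perm_orbit extremal_matrix) = 192" by (rule card_orbit_extremal)
qed

end
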